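(* Let $n\ge1$. If $\pi\in\mathcal S_n(132,213)$ has $\kappa(\pi)=(a_1,a_2,a_3)$, then $\pi\in\mathcal C_n(132,213)$ if and only if $\gcd(a_1+a_2,\,a_2+a_3)=1$.
   Context: $\mathcal S_n(132,213)$ is the set of permutations of $\{1,\dots,n\}$ which, in one-line notation, avoid the patterns $132$ and $213$; $\mathcal C_n(132,213)$ is the subset of those that are cyclic, i.e. whose cycle decomposition is a single cycle of length $n$. For $\sigma\in\mathcal S_p$ and $\tau\in\mathcal S_q$, the skew sum is $\sigma\ominus\tau=(\sigma_1+q)\cdots(\sigma_p+q)\,\tau_1\cdots\tau_q$, and $\mathrm{id}_a=12\cdots a$. Every $\pi\in\mathcal S_n(132,213)$ is uniquely of the form $\mathrm{id}_{a_1}\ominus\cdots\ominus\mathrm{id}_{a_k}$ with $(a_1,\dots,a_k)$ a composition of $n$ (a tuple of positive integers with sum $n$); write $\kappa(\pi)=(a_1,\dots,a_k)$. *)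

theory Defs
  imports "HOL-Combinatorics.Cycles" "HOL-Library.Sublist"
begin

text \<open>
  A permutation of \<open>{1..n}\<close> is a function with \<open>\<pi> permutes {1..n}\<close>.  Patterns, and the
  operands of skew sums, are given in one-line notation, as lists over \<open>{1..k}\<close>.
\<close>

definition one_line :: "nat \<Rightarrow> (nat \<Rightarrow> nat) \<Rightarrow> nat list" where
  "one_line n \<pi> = map \<pi> [1..<Suc n]"

definition order_isomorphic :: "nat list \<Rightarrow> nat list \<Rightarrow> bool" where
  "order_isomorphic v p \<longleftrightarrow>
     length v = length p \<and> (\<forall>i < length p. \<forall>j < length p. v ! i < v ! j \<longleftrightarrow> p ! i < p ! j)"

definition contains_pattern :: "nat list \<Rightarrow> nat list \<Rightarrow> bool" where
  "contains_pattern w p \<longleftrightarrow> (\<exists>v. subseq v w \<and> order_isomorphic v p)"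

definition avoiding_perms :: "nat \<Rightarrow> nat list set \<Rightarrow> (nat \<Rightarrow> nat) set" where
  "avoiding_perms n P =
     {\<pi>. \<pi> permutes {1..n} \<and> (\<forall>p \<in> P. \<not> contains_pattern (one_line n \<pi>) p)}"

definition is_cyclic :: "nat \<Rightarrow> (nat \<Rightarrow> nat) \<Rightarrow> bool" where
  "is_cyclic n \<pi> \<longleftrightarrow>
     (\<exists>cs. cycle cs \<and> length cs = n \<and> set cs = {1..n} \<and> \<pi> = cycle_of_list cs)"

definition cyclic_avoiding_perms :: "nat \<Rightarrow> nat list set \<Rightarrow> (nat \<Rightarrow> nat) set" where
  "cyclic_avoiding_perms n P = {\<pi> \<in> avoiding_perms n P. is_cyclic n \<pi>}"

definition skew_sum :: "nat list \<Rightarrow> nat list \<Rightarrow> nat list" (infixr "\<ominus>" 65) where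
  "\<sigma> \<ominus> \<tau> = map (\<lambda>x. x + length \<tau>) \<sigma> @ \<tau>"

definition id_word :: "nat \<Rightarrow> nat list" where
  "id_word a = [1..<Suc a]"

definition skew_sum_ids :: "nat list \<Rightarrow> nat list" where
  "skew_sum_ids as = foldr (\<ominus>) (map id_word as) []"

definition is_composition :: "nat \<Rightarrow> nat list \<Rightarrow> bool" where
  "is_composition n as \<longleftrightarrow> (\<forall>a \<in> set as. 0 < a) \<and> sum_list as = n"

text \<open>
  Meaningful for \<open>\<pi> \<in> avoiding_perms n {[1,3,2], [2,1,3]}\<close>, where exactly one such composition
  exists (lemma \<open>ex1_kappa\<close> below).
\<close>

definition kappa :: "nat \<Rightarrow> (nat \<Rightarrow> nat) \<Rightarrow> nat list" where
  "kappa n \<pi> = (THE as. is_composition n as \<and> one_line n \<pi> = skew_sum_ids as)"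

lemma skew_sum_ids_Nil: "skew_sum_ids [] = []"
  by (simp add: skew_sum_ids_def)

lemma skew_sum_ids_Cons: "skew_sum_ids (a # as) = id_word a \<ominus> skew_sum_ids as"
  by (simp add: skew_sum_ids_def)

lemma length_skew_sum_ids: "length (skew_sum_ids as) = sum_list as"
  by (induction as) (simp_all add: skew_sum_ids_Nil skew_sum_ids_Cons skew_sum_def id_word_def)

lemma skew_sum_ids_inject:
  assumes "\<forall>a \<in> set as. 0 < a" "\<forall>b \<in> set bs. 0 < b" "skew_sum_ids as = skew_sum_ids bs"
  shows "as = bs"
  using assms
proof (induction as arbitrary: bs)
  case Nil
  then have "sum_list bs = 0"
    by (metis length_skew_sum_ids sum_list.Nil)
  with Nil show ?case by (cases bs) auto
next
  case (Cons a as)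
  have len: "sum_list (a # as) = sum_list bs"
    using Cons.prems by (metis length_skew_sum_ids)
  with Cons.prems(1) obtain b bs' where bs: "bs = b # bs'" by (cases bs) auto
  have hd: "hd (skew_sum_ids (c # cs)) = Suc (sum_list cs)" if "0 < c" for c cs
    using that by (simp add: skew_sum_ids_Cons skew_sum_def id_word_def upt_rec length_skew_sum_ids)
  have sums: "sum_list as = sum_list bs'"
    using hd[of a as] hd[of b bs'] Cons.prems bs by simp
  with len bs have ab: "a = b" by simp
  have "skew_sum_ids as = skew_sum_ids bs'"
    using Cons.prems(3) bs ab by (simp add: skew_sum_ids_Cons skew_sum_def length_skew_sum_ids sums)
  with Cons.IH[of bs'] Cons.prems bs ab show ?case by simp
qed

lemma contains_patternI3:
  assumes "subseq [x, y, z] w" "order_isomorphic [x, y, z] p"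
  shows "contains_pattern w p"
  using assms unfolding contains_pattern_def by blast

lemma order_isomorphic_132: "x < z \<Longrightarrow> z < y \<Longrightarrow> order_isomorphic [x, y, z] [1, 3, 2]"
  by (auto simp: order_isomorphic_def less_Suc_eq nth_Cons')

lemma order_isomorphic_213: "y < x \<Longrightarrow> x < z \<Longrightarrow> order_isomorphic [x, y, z] [2, 1, 3]"
  by (auto simp: order_isomorphic_def less_Suc_eq nth_Cons')

lemma avoiding_word_decomposition:
  assumes "distinct w" "set w = {1..n}"
    and "\<not> contains_pattern w [1, 3, 2]" "\<not> contains_pattern w [2, 1, 3]"
  shows "\<exists>as. is_composition n as \<and> w = skew_sum_ids as"
  using assms
proof (induction n arbitrary: w rule: less_induct)
  case (less n)
  show ?case
  proof (cases w)
    case Nil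
    then have "n = 0" using less.prems(2) by auto
    with Nil show ?thesis
      by (intro exI[of _ "[]"]) (simp add: is_composition_def skew_sum_ids_Nil)
  next
    case (Cons x u)
    have x: "1 \<le> x" "x \<le> n" using less.prems(2) Cons by auto
    define hi where "hi = takeWhile (\<lambda>y. x \<le> y) w"
    define lo where "lo = dropWhile (\<lambda>y. x \<le> y) w"
    have w: "w = hi @ lo" by (simp add: hi_def lo_def)
    have hi_ge: "\<forall>y \<in> set hi. x \<le> y" by (auto simp: hi_def dest: set_takeWhileD)
    have hi_x: "hi = x # tl hi" by (simp add: hi_def Cons)
    have lo_less: "y < x" if "y \<in> set lo" for y
    proof (rule ccontr)
      assume "\<not> y < x"
      obtain l lo' where lo: "lo = l # lo'" using \<open>y \<in> set lo\<close> by (cases lo) auto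
      have "l < x" using lo unfolding lo_def
        by (metis dropWhile_eq_Cons_conv linorder_not_less)
      moreover have "y \<in> set lo'" "y \<noteq> x"
        using that lo \<open>l < x\<close> \<open>\<not> y < x\<close> less.prems(1) w hi_x
        by (auto, metis disjoint_iff distinct_append list.set_intros)
      moreover have "subseq [x, l, y] w"
      proof -
        have "subseq [l, y] lo" using lo \<open>y \<in> set lo'\<close> by (simp add: subseq_singleton_left)
        moreover have "subseq [x] hi" using hi_x by (metis list.set_intros(1) subseq_singleton_left)
        ultimately have "subseq ([x] @ [l, y]) (hi @ lo)" by (rule list_emb_append_mono[rotated])
        then show ?thesis by (simp add: w)
      qed
      ultimately show False
        using less.prems(4) \<open>\<not> y < x\<close> contains_patternI3 order_isomorphic_213
        by (meson linorder_neqE_nat)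
    qed
    have "sorted (tl hi)"
    proof (rule ccontr)
      assume "\<not> sorted (tl hi)"
      then obtain i j where ij: "i < j" "j < length (tl hi)" "tl hi ! j < tl hi ! i"
        by (metis linorder_not_less sorted_wrt_iff_nth_less)
      have xn: "x \<notin> set (tl hi)"
        using less.prems(1) w hi_x by (metis distinct.simps(2) distinct_append)
      have "tl hi ! j \<in> set (tl hi)" using ij by simp
      with xn hi_ge hi_x have "x < tl hi ! j"
        by (metis le_neq_implies_less list.set_intros(2))
      moreover have "subseq [tl hi ! i, tl hi ! j] (tl hi)"
      proof -
        have 1: "tl hi = take j (tl hi) @ drop j (tl hi)" by simp
        have "subseq [tl hi ! i] (take j (tl hi))"
          using ij by (auto simp: subseq_singleton_left in_set_conv_nth intro!: exI[of _ i])
        moreover have "subseq [tl hi ! j] (drop j (tl hi))"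
          using ij by (simp add: subseq_singleton_left Cons_nth_drop_Suc[symmetric])
        ultimately have "subseq ([tl hi ! i] @ [tl hi ! j]) (take j (tl hi) @ drop j (tl hi))"
          by (rule list_emb_append_mono)
        then show ?thesis by simp
      qed
      then have "subseq [x, tl hi ! i, tl hi ! j] hi"
        by (metis hi_x subseq_Cons2)
      then have "subseq [x, tl hi ! i, tl hi ! j] w"
        unfolding w by (rule list_emb_prefix)
      ultimately show False
        using ij less.prems(3) contains_patternI3 order_isomorphic_132 by blast
    qed
    then have "sorted hi"
      using hi_x hi_ge by (metis list.set_intros(2) sorted_simps(2))
    moreover have "distinct hi" using less.prems(1) w by simp
    moreover have union: "set hi \<union> set lo = {1..n}" using less.prems(2) w by simp
    have hi_iff: "y \<in> set hi \<longleftrightarrow> y \<in> set hi \<union> set lo \<and> x \<le> y" for y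
      using hi_ge lo_less[of y] by auto
    have "set hi = {x..n}" using hi_iff x unfolding union set_eq_iff atLeastAtMost_iff
      by (meson order_trans)
    moreover have lo_iff: "y \<in> set lo \<longleftrightarrow> y \<in> set hi \<union> set lo \<and> y < x" for y
      using hi_ge lo_less[of y] by auto
    have set_lo: "set lo = {1..x - 1}"
      unfolding set_eq_iff lo_iff union atLeastAtMost_iff using x by auto
    ultimately have hi: "hi = [x..<Suc n]"
      by (metis atLeastLessThanSuc_atLeastAtMost distinct_upt set_upt sorted_distinct_set_unique
          sorted_upt)
    have sub: "subseq lo w" unfolding w by (rule list_emb_append2) simp
    have "\<exists>as. is_composition (x - 1) as \<and> lo = skew_sum_ids as"
    proof (rule less.IH)
      show "x - 1 < n" using x by simp
      show "distinct lo" using less.prems(1) w by simp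
      show "set lo = {1..x - 1}" by (rule set_lo)
      show "\<not> contains_pattern lo [1, 3, 2]" "\<not> contains_pattern lo [2, 1, 3]"
        using less.prems(3,4) sub subseq_order.trans unfolding contains_pattern_def by blast+
    qed
    then obtain as where as: "is_composition (x - 1) as" "lo = skew_sum_ids as" by blast
    have "length lo = x - 1" using as by (simp add: length_skew_sum_ids is_composition_def)
    moreover have "map (\<lambda>y. y + (x - 1)) [1..<Suc (n - (x - 1))] = [x..<Suc n]"
      using x by (intro nth_equalityI) (simp_all del: upt_Suc)
    ultimately have "w = skew_sum_ids ((n - (x - 1)) # as)"
      using x as(2) w hi
      by (simp add: skew_sum_ids_Cons skew_sum_def id_word_def del: upt_Suc)
    moreover have "is_composition n ((n - (x - 1)) # as)"
      using as(1) x by (auto simp: is_composition_def)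
    ultimately show ?thesis by blast
  qed
qed

lemma ex1_kappa:
  assumes "\<pi> \<in> avoiding_perms n {[1, 3, 2], [2, 1, 3]}"
  shows "\<exists>!as. is_composition n as \<and> one_line n \<pi> = skew_sum_ids as"
proof -
  have perm: "\<pi> permutes {1..n}" using assms by (simp add: avoiding_perms_def)
  have "distinct (one_line n \<pi>)"
    using permutes_inj_on[OF perm] by (simp add: one_line_def distinct_map del: upt_Suc)
  moreover have "set (one_line n \<pi>) = {1..n}"
    using permutes_image[OF perm]
    by (simp add: one_line_def atLeastLessThanSuc_atLeastAtMost del: upt_Suc)
  ultimately have "\<exists>as. is_composition n as \<and> one_line n \<pi> = skew_sum_ids as"
    using assms by (intro avoiding_word_decomposition) (auto simp: avoiding_perms_def)
  then obtain as where as: "is_composition n as" "one_line n \<pi> = skew_sum_ids as" by blast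
  show ?thesis
  proof (rule ex1I[of _ as])
    show "is_composition n as \<and> one_line n \<pi> = skew_sum_ids as" using as by blast
  next
    fix bs assume "is_composition n bs \<and> one_line n \<pi> = skew_sum_ids bs"
    with as have "is_composition n as" "is_composition n bs" "skew_sum_ids bs = skew_sum_ids as"
      by simp_all
    then show "bs = as"
      by (simp add: is_composition_def skew_sum_ids_inject)
  qed
qed

end

theory Submission
  imports Defs "HOL-Number_Theory.Cong"
begin

text \<open>
  Let \<open>p = a\<^sub>1 + a\<^sub>2\<close> and \<open>q = a\<^sub>2 + a\<^sub>3\<close>.  The permutation with block sizes \<open>a\<^sub>1, a\<^sub>2, a\<^sub>3\<close> reverses the
  order of three intervals, translating them by \<open>q\<close>, \<open>q - p\<close> and \<open>-p\<close> respectively.  Such a map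
  is a rotation in disguise.  Append \<open>a\<^sub>2\<close> further points to \<open>{1..n}\<close>, which gives
  \<open>n + a\<^sub>2 = p + q\<close> points, and let \<open>R\<close> be the rotation of \<open>{1..p + q}\<close> by \<open>q\<close> places.  A point of the
  outer intervals is moved by \<open>R\<close> exactly as by \<open>\<pi>\<close>; a point of the middle interval is sent by \<open>R\<close> to
  one of the new points, and from there, by a second step, to its image under \<open>\<pi>\<close>.  So \<open>\<pi>\<close> is the
  first return map of \<open>R\<close> to \<open>{1..n}\<close> (lemma \<open>skew_sum_ids_first_return\<close>).

  If \<open>p\<close> and \<open>q\<close> are coprime, then \<open>q\<close> is coprime to \<open>p + q\<close>, so \<open>R\<close> has a single orbit
  (\<open>rotate_interval_transitive\<close>), and its return map \<open>\<pi>\<close> inherits this because an orbit of \<open>R\<close>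
  consists of an orbit of \<open>\<pi>\<close> and the new points visited in between
  (\<open>rotate_interval_orbit_via_return\<close>).  Conversely \<open>R\<close>, and with it \<open>\<pi>\<close>, preserves residues
  modulo \<open>gcd p q\<close>; a single orbit contains both \<open>1\<close> and \<open>2\<close>, which forces the gcd to be \<open>1\<close>.
\<close>

text \<open>The cycle through \<open>1\<close>, read off as the list of iterates, exhausts \<open>{1..n}\<close> in the
  transitive case; in the other direction, iterating a cycle rotates its list of entries, so each
  entry can be brought to the front.\<close>

lemma is_cyclic_iff_transitive:
  assumes perm: "\<pi> permutes {1..n}" and n: "1 \<le> n"
  shows "is_cyclic n \<pi> \<longleftrightarrow> (\<forall>x\<in>{1..n}. \<forall>y\<in>{1..n}. \<exists>k. (\<pi> ^^ k) x = y)"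
proof
  assume "is_cyclic n \<pi>"
  then obtain cs where cs: "cycle cs" "length cs = n" "set cs = {1..n}" "\<pi> = cycle_of_list cs"
    unfolding is_cyclic_def by blast
  show "\<forall>x\<in>{1..n}. \<forall>y\<in>{1..n}. \<exists>k. (\<pi> ^^ k) x = y"
  proof (intro ballI)
    fix x y assume "x \<in> {1..n}" "y \<in> {1..n}"
    then obtain i j where ij: "i < n" "cs ! i = x" "j < n" "cs ! j = y"
      using cs(2,3) by (metis in_set_conv_nth)
    have "(\<pi> ^^ (n - i + j)) x = map (\<pi> ^^ (n - i + j)) cs ! i"
      using ij cs(2) by simp
    also have "\<dots> = rotate (n - i + j) cs ! i"
      using cyclic_rotation[OF cs(1)] cs(4) by simp
    also have "\<dots> = cs ! ((n - i + j + i) mod n)"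
      using ij cs(2) by (simp add: nth_rotate)
    also have "\<dots> = y"
      using ij by simp
    finally show "\<exists>k. (\<pi> ^^ k) x = y" by blast
  qed
next
  assume trans: "\<forall>x\<in>{1..n}. \<forall>y\<in>{1..n}. \<exists>k. (\<pi> ^^ k) x = y"
  define cs where "cs = support \<pi> 1"
  have permutation: "permutation \<pi>"
    using perm by (auto simp: permutation_permutes)
  have dist: "cycle cs"
    unfolding cs_def by (rule cycle_of_permutation[OF permutation])
  have "(\<pi> ^^ k) 1 \<in> {1..n}" for k
    using permutes_in_image[OF permutes_funpow[OF perm]] n by auto
  moreover have "\<exists>k. (\<pi> ^^ k) 1 = y" if "y \<in> {1..n}" for y
    using trans n that by auto
  ultimately have set: "set cs = {1..n}"
    unfolding cs_def support_set[OF permutation] by blast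
  have "\<pi> x = cycle_of_list cs x" for x
  proof (cases "x \<in> set cs")
    case True
    then show ?thesis
      using cycle_restrict[OF permutation] unfolding cs_def by blast
  next
    case False
    then show ?thesis
      using permutes_not_in[OF perm] set by (simp add: id_outside_supp)
  qed
  moreover have "length cs = n"
    using distinct_card[OF dist] set by simp
  ultimately show "is_cyclic n \<pi>"
    unfolding is_cyclic_def using dist set by blast
qed

text \<open>Rotation of \<open>{1..p + q}\<close> by \<open>q\<close> places; no value is intended elsewhere.  The case
  distinction, instead of reduction modulo \<open>p + q\<close>, keeps the representatives in \<open>{1..p + q}\<close> and
  exhibits the map as an exchange of two intervals.\<close>

definition rotate_interval :: "nat \<Rightarrow> nat \<Rightarrow> nat \<Rightarrow> nat" where
  "rotate_interval p q x = (if x \<le> p then x + q else x - p)"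

lemma rotate_interval_funpow_mem:
  "x \<in> {1..p + q} \<Longrightarrow> (rotate_interval p q ^^ k) x \<in> {1..p + q}"
  by (induction k) (auto simp: rotate_interval_def)

lemma rotate_interval_cong: "[rotate_interval p q x = x + q] (mod (p + q))"
proof (cases "x \<le> p")
  case False
  then have shift: "x + q = rotate_interval p q x + (p + q)"
    by (simp add: rotate_interval_def)
  show ?thesis
    by (simp only: cong_def shift mod_add_self2)
qed (simp add: rotate_interval_def)

lemma rotate_interval_funpow_cong:
  "[(rotate_interval p q ^^ k) x = x + k * q] (mod (p + q))"
proof (induction k)
  case (Suc k)
  have "[(rotate_interval p q ^^ Suc k) x = (rotate_interval p q ^^ k) x + q] (mod (p + q))"
    using rotate_interval_cong by simp
  also have "[(rotate_interval p q ^^ k) x + q = x + k * q + q] (mod (p + q))"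
    by (rule cong_add[OF Suc cong_refl])
  finally show ?case by (simp add: algebra_simps)
qed simp

lemma rotate_interval_cong_gcd: "[rotate_interval p q x = x] (mod gcd p q)"
proof -
  have "[rotate_interval p q x = x + q] (mod gcd p q)"
    using rotate_interval_cong by (rule cong_dvd_modulus_nat) simp
  also have "[x + q = x + 0] (mod gcd p q)"
    by (intro cong_add cong_refl) (simp add: cong_0_iff)
  finally show ?thesis by simp
qed

lemma rotate_interval_transitive:
  assumes "coprime p q" and x: "x \<in> {1..p + q}" and y: "y \<in> {1..p + q}"
  shows "\<exists>k. (rotate_interval p q ^^ k) x = y"
proof -
  have "coprime q (p + q)"
    using assms(1) by (simp add: coprime_iff_gcd_eq_1 gcd.commute add.commute[of p])
  then obtain u where u: "[q * u = 1] (mod (p + q))"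
    using cong_solve_coprime_nat by auto
  \<comment> \<open>The distance \<open>y - x\<close>, made nonnegative by one full turn, times the inverse \<open>u\<close> of \<open>q\<close>.\<close>
  define d where "d = y + (p + q) - x"
  have "[(rotate_interval p q ^^ (u * d)) x = x + u * d * q] (mod (p + q))"
    by (rule rotate_interval_funpow_cong)
  also have "[x + u * d * q = x + 1 * d] (mod (p + q))"
    using cong_add[OF cong_refl cong_mult[OF u cong_refl]] by (simp add: mult_ac)
  also have "[x + 1 * d = y] (mod (p + q))"
    using x by (simp add: d_def cong_def)
  finally have c: "[(rotate_interval p q ^^ (u * d)) x = y] (mod (p + q))" .
  have "(rotate_interval p q ^^ (u * d)) x = y"
  proof -
    let ?z = "(rotate_interval p q ^^ (u * d)) x"
    \<comment> \<open>Shifted down by one, both points lie in \<open>{0..<p + q}\<close>, where congruence is equality.\<close>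
    have z: "?z \<in> {1..p + q}"
      using x by (rule rotate_interval_funpow_mem)
    have "[(?z - 1) + 1 = (y - 1) + 1] (mod (p + q))"
      using c z y by simp
    then have "[?z - 1 = y - 1] (mod (p + q))"
      by (simp only: cong_add_rcancel_nat)
    then have "?z - 1 = y - 1"
      using z y by (intro cong_less_imp_eq_nat[of _ "p + q"]) auto
    then show ?thesis using z y unfolding atLeastAtMost_iff by linarith
  qed
  then show ?thesis by blast
qed

lemma skew_sum_ids_three_nth:
  assumes "i < a + b + c"
  shows "skew_sum_ids [a, b, c] ! i =
    (if i < a then i + 1 + b + c else if i < a + b then i - a + 1 + c else i - (a + b) + 1)"
  using assms
  by (auto simp: skew_sum_ids_Cons skew_sum_ids_Nil skew_sum_def id_word_def nth_append
      simp del: upt_Suc)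

text \<open>The middle interval \<open>{a<..a + b}\<close> is the one that the rotation takes out of \<open>{1..a + b + c}\<close>.\<close>

lemma skew_sum_ids_first_return:
  assumes word: "one_line n \<pi> = skew_sum_ids [a, b, c]"
    and n: "n = a + b + c" and x: "x \<in> {1..n}"
  defines "R \<equiv> rotate_interval (a + b) (b + c)"
  shows "\<pi> x = (if x \<in> {a<..a + b} then R (R x) else R x)"
proof -
  have "\<pi> x = one_line n \<pi> ! (x - 1)"
    using x by (auto simp: one_line_def simp del: upt_Suc)
  also have "\<dots> = (if x - 1 < a then x - 1 + 1 + b + c
      else if x - 1 < a + b then x - 1 - a + 1 + c else x - 1 - (a + b) + 1)"
    unfolding word using x n by (intro skew_sum_ids_three_nth) auto
  finally show ?thesis
    using x n by (auto simp: R_def rotate_interval_def)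
qed

text \<open>A point on a rotation orbit is at a visit to the base interval or one step after a visit to
  the part of it that leaves.\<close>

lemma rotate_interval_orbit_via_return:
  assumes ret: "\<And>x. x \<in> {1..n} \<Longrightarrow> \<pi> x = (if x \<in> A then R (R x) else R x)"
    and mem: "\<And>x. x \<in> {1..n} \<Longrightarrow> \<pi> x \<in> {1..n}" and x: "x \<in> {1..n}"
  shows "\<exists>m. (R ^^ k) x = (\<pi> ^^ m) x \<or> (\<pi> ^^ m) x \<in> A \<and> (R ^^ k) x = R ((\<pi> ^^ m) x)"
proof (induction k)
  case 0
  show ?case by (intro exI[of _ 0]) simp
next
  case (Suc k)
  have orbit: "(\<pi> ^^ m) x \<in> {1..n}" for m
    using x mem by (induction m) auto
  from Suc obtain m where
    "(R ^^ k) x = (\<pi> ^^ m) x \<or> (\<pi> ^^ m) x \<in> A \<and> (R ^^ k) x = R ((\<pi> ^^ m) x)" by blast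
  then show ?case
  proof (elim disjE conjE)
    assume at: "(R ^^ k) x = (\<pi> ^^ m) x"
    show ?thesis
    proof (cases "(\<pi> ^^ m) x \<in> A")
      case True
      then show ?thesis using at by (intro exI[of _ m]) simp
    next
      case False
      then show ?thesis using at ret[OF orbit[of m]] by (intro exI[of _ "Suc m"]) simp
    qed
  next
    assume "(\<pi> ^^ m) x \<in> A" "(R ^^ k) x = R ((\<pi> ^^ m) x)"
    then show ?thesis using ret[OF orbit[of m]] by (intro exI[of _ "Suc m"]) simp
  qed
qed

theorem theorem5p2:
  fixes n a\<^sub>1 a\<^sub>2 a\<^sub>3 :: nat and \<pi> :: "nat \<Rightarrow> nat"
  assumes "n \<ge> 1"
    and "\<pi> \<in> avoiding_perms n {[1, 3, 2], [2, 1, 3]}"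
    and "kappa n \<pi> = [a\<^sub>1, a\<^sub>2, a\<^sub>3]"
  shows "\<pi> \<in> cyclic_avoiding_perms n {[1, 3, 2], [2, 1, 3]} \<longleftrightarrow>
         gcd (a\<^sub>1 + a\<^sub>2) (a\<^sub>2 + a\<^sub>3) = 1"
proof -
  define p q R where "p = a\<^sub>1 + a\<^sub>2" and "q = a\<^sub>2 + a\<^sub>3" and "R = rotate_interval p q"
  have perm: "\<pi> permutes {1..n}"
    using assms(2) by (simp add: avoiding_perms_def)
  have kappa: "is_composition n [a\<^sub>1, a\<^sub>2, a\<^sub>3] \<and> one_line n \<pi> = skew_sum_ids [a\<^sub>1, a\<^sub>2, a\<^sub>3]"
    using theI'[OF ex1_kappa[OF assms(2)]] assms(3) unfolding kappa_def by simp
  then have pos: "0 < a\<^sub>1" "0 < a\<^sub>2" "0 < a\<^sub>3" and n: "n = a\<^sub>1 + a\<^sub>2 + a\<^sub>3"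
    and word: "one_line n \<pi> = skew_sum_ids [a\<^sub>1, a\<^sub>2, a\<^sub>3]"
    by (auto simp: is_composition_def)
  have ret: "\<pi> x = (if x \<in> {a\<^sub>1<..a\<^sub>1 + a\<^sub>2} then R (R x) else R x)" if "x \<in> {1..n}" for x
    using skew_sum_ids_first_return[OF word n that] by (simp add: R_def p_def q_def)
  have mem: "\<pi> x \<in> {1..n}" if "x \<in> {1..n}" for x
    using that permutes_in_image[OF perm] by blast
  have funpow_mem: "(\<pi> ^^ m) x \<in> {1..n}" if "x \<in> {1..n}" for x m
    using that permutes_in_image[OF permutes_funpow[OF perm]] by blast
  have "is_cyclic n \<pi> \<longleftrightarrow> gcd p q = 1"
  proof
    assume "is_cyclic n \<pi>"
    moreover have "1 \<in> {1..n}" "2 \<in> {1..n}"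
      using n pos by auto
    ultimately obtain k where k: "(\<pi> ^^ k) 1 = 2"
      using is_cyclic_iff_transitive[OF perm assms(1)] by blast
    have step: "[\<pi> x = x] (mod gcd p q)" if "x \<in> {1..n}" for x
    proof -
      have R: "[R z = z] (mod gcd p q)" for z
        unfolding R_def by (rule rotate_interval_cong_gcd)
      then have "[R (R x) = x] (mod gcd p q)"
        by (rule cong_trans) (rule R)
      then show ?thesis
        using ret[OF that] R[of x] by simp
    qed
    have "[(\<pi> ^^ m) 1 = 1] (mod gcd p q)" for m
    proof (induction m)
      case (Suc m)
      have "[\<pi> ((\<pi> ^^ m) 1) = (\<pi> ^^ m) 1] (mod gcd p q)"
        using assms(1) by (intro step funpow_mem) simp
      from cong_trans[OF this Suc] show ?case by simp
    qed simp
    from this[of k] have "[1 + 1 = 1 + 0] (mod gcd p q)"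
      by (simp add: k numeral_2_eq_2 del: One_nat_def)
    then have "[1 = 0] (mod gcd p q)"
      by (simp only: cong_add_lcancel_nat)
    then show "gcd p q = 1"
      by (simp add: cong_0_iff)
  next
    assume gcd: "gcd p q = 1"
    show "is_cyclic n \<pi>"
      unfolding is_cyclic_iff_transitive[OF perm assms(1)]
    proof (intro ballI)
      fix x y assume x: "x \<in> {1..n}" and y: "y \<in> {1..n}"
      obtain k where k: "(R ^^ k) x = y"
        using rotate_interval_transitive[of p q x y] gcd x y n
        by (auto simp: R_def p_def q_def coprime_iff_gcd_eq_1)
      obtain m where m: "(R ^^ k) x = (\<pi> ^^ m) x \<or>
          (\<pi> ^^ m) x \<in> {a\<^sub>1<..a\<^sub>1 + a\<^sub>2} \<and> (R ^^ k) x = R ((\<pi> ^^ m) x)"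
        using rotate_interval_orbit_via_return[OF ret mem x] by blast
      \<comment> \<open>As \<open>y \<le> n\<close>, it is not one of the new points, which are the images of the middle interval.\<close>
      have "R z > n" if "z \<in> {a\<^sub>1<..a\<^sub>1 + a\<^sub>2}" for z
        using that by (auto simp: R_def rotate_interval_def p_def q_def n)
      with m k y have "(\<pi> ^^ m) x = y"
        by (metis atLeastAtMost_iff linorder_not_less)
      then show "\<exists>k. (\<pi> ^^ k) x = y" by blast
    qed
  qed
  then show ?thesis
    using assms(2) by (simp add: cyclic_avoiding_perms_def p_def q_def)
qed

end
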